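(* Let $b(x)=\log|x|$ for $x\in\mathbb{R}\setminus\{0\}$ and let $H$ be the Hilbert transform on $\mathbb{R}$. Then there exists a constant $c>0$ such that, for every $t>0$, $$\left|\left\{x\in(0,1)\,:\,\left|[b,H](\chi_{(0,1)})(x)\right|>t\right\}\right|\geq e^{-\sqrt{ct}}.$$
   Context: $|E|$ denotes the Lebesgue measure of $E\subset\mathbb{R}$ and $\chi_E$ is the characteristic function of $E$. The Hilbert transform is normalized as $Hf(x)=\mathrm{p.v.}\int_{\mathbb{R}}\frac{f(y)}{x-y}\,dy$. The commutator is $[b,H]f=b\,H(f)-H(bf)$, i.e. $[b,H]f(x)=\mathrm{p.v.}\int_{\mathbb{R}}\frac{b(x)-b(y)}{x-y}f(y)\,dy$; for $f=\chi_{(0,1)}$ and $x\in(0,1)$ this is the absolutely convergent integral $\int_0^1\frac{\log x-\log y}{x-y}\,dy$. *)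

theory Defs
  imports "HOL-Analysis.Analysis"
begin

text \<open>The principal value is the limit, as \<open>\<epsilon>\<close> decreases to 0, of the Lebesgue integrals over
  \<open>\<bar>x - y\<bar> > \<epsilon>\<close>; the normalization has no factor \<open>1/\<pi>\<close>. As usual for \<^const>\<open>Lim\<close>, the value is
  unspecified at points where the limit does not exist.\<close>

definition hilbert_transform :: "(real \<Rightarrow> real) \<Rightarrow> real \<Rightarrow> real" where
  "hilbert_transform f x =
     Lim (at_right 0) (\<lambda>\<epsilon>. LINT y:{y. \<epsilon> < \<bar>x - y\<bar>}|lebesgue. f y / (x - y))"

definition commutator ::
    "(real \<Rightarrow> real) \<Rightarrow> ((real \<Rightarrow> real) \<Rightarrow> real \<Rightarrow> real) \<Rightarrow> (real \<Rightarrow> real) \<Rightarrow> real \<Rightarrow> real" where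
  "commutator b T f x = b x * T f x - T (\<lambda>y. b y * f y) x"

text \<open>At 0, where \<open>log\<bar>x\<bar>\<close> is undefined, the value is \<open>ln 0 = 0\<close>; this affects a null set only.\<close>

definition log_abs :: "real \<Rightarrow> real" where
  "log_abs x = ln \<bar>x\<bar>"

end

theory Submission imports Defs "HOL-Real_Asymp.Real_Asymp" begin

text \<open>On \<open>(0,1)\<close> the commutator is the integral of the nonnegative kernel
  \<open>(ln x - ln y) / (x - y)\<close> over \<open>0 < y < 1\<close>. Since the kernel is at least \<open>ln (y / x) / y\<close> for
  \<open>y > x\<close>, and the latter has antiderivative \<open>ln (y / x)\<^sup>2 / 2\<close>, the commutator is at least
  \<open>(ln x)\<^sup>2 / 2\<close>. This exceeds \<open>t\<close> on the interval \<open>(0, exp (- sqrt (2 * t)))\<close>, so \<open>c = 2\<close> works.\<close>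

section \<open>The kernel and its integrability\<close>

text \<open>The indicator hides the default values of \<open>ln\<close> at nonpositive arguments. On
  the diagonal, division by zero gives 0 instead of the limit \<open>1 / x\<close>, which concerns a
  single \<open>y\<close> for each \<open>x\<close>.\<close>

definition log_kernel :: "real \<Rightarrow> real \<Rightarrow> real" where
  "log_kernel x y = indicat_real {0<..<1} y * ((ln x - ln y) / (x - y))"

text \<open>Joint measurability makes the integral over \<open>y\<close> a measurable function of
  \<open>x\<close>, hence its superlevel sets measurable.\<close>

lemma measurable_log_kernel [measurable]:
  "(\<lambda>(x, y). log_kernel x y) \<in> borel_measurable (borel \<Otimes>\<^sub>M borel)"
  unfolding log_kernel_def by measurable

lemma log_kernel_nonneg:
  assumes "0 < x"
  shows "0 \<le> log_kernel x y"
  using assms by (auto simp: log_kernel_def indicator_def divide_le_0_iff zero_le_divide_iff)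

text \<open>On the unit interval \<open>- ln x\<close> is nonnegative with antiderivative
  \<open>x - x * ln x\<close>, which has finite limits at both ends.\<close>

lemma set_integrable_ln: "set_integrable lborel {0<..<1} (ln :: real \<Rightarrow> real)"
proof -
  have "set_integrable lborel (einterval 0 1) (\<lambda>x. - ln x)"
  proof (rule interval_integral_FTC_nonneg)
    show "((\<lambda>x. x - x * ln x) has_real_derivative - ln x) (at x)" if "0 < ereal x" for x
      using that by (auto intro!: derivative_eq_intros)
    have "((\<lambda>x::real. x - x * ln x) \<longlongrightarrow> 0) (at_right 0)" by real_asymp
    then show "(((\<lambda>x. x - x * ln x) \<circ> real_of_ereal) \<longlongrightarrow> 0) (at_right 0)"
      by (simp add: ereal_tendsto_simps zero_ereal_def)
    have "((\<lambda>x::real. x - x * ln x) \<longlongrightarrow> 1) (at_left 1)" by real_asymp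
    then show "(((\<lambda>x. x - x * ln x) \<circ> real_of_ereal) \<longlongrightarrow> 1) (at_left 1)"
      by (simp add: ereal_tendsto_simps one_ereal_def)
  qed (auto intro!: continuous_intros)
  moreover have "einterval 0 1 = {0<..<1}"
    by (auto simp: einterval_def)
  ultimately have "set_integrable lborel {0<..<1} (\<lambda>x::real. - (- ln x))"
    unfolding set_integrable_def by (auto dest: integrable_minus)
  then show ?thesis by simp
qed

text \<open>For \<open>y < x / 2\<close> the denominator exceeds \<open>x / 2\<close>. For other
  \<open>y\<close> the difference quotient of \<open>ln\<close> is at most 1 over the smaller of
  \<open>x\<close> and \<open>y\<close>, hence at most \<open>2 / x\<close>. With \<open>x\<close>
  fixed, only the integrable singularity of \<open>ln y\<close> is left.\<close>

lemma log_kernel_le: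
  assumes "0 < x"
  shows "log_kernel x y \<le> indicat_real {0<..<1} y * (2 / x * (1 + \<bar>ln x\<bar> + \<bar>ln y\<bar>))"
proof (cases "0 < y \<and> y < 1 \<and> y \<noteq> x")
  case y: True
  have "(ln x - ln y) / (x - y) \<le> 2 / x * (1 + \<bar>ln x\<bar> + \<bar>ln y\<bar>)"
  proof (cases "y < x / 2")
    case True
    have "(ln x - ln y) / (x - y) \<le> (1 + \<bar>ln x\<bar> + \<bar>ln y\<bar>) / (x / 2)"
      using True assms by (intro frac_le) auto
    also have "\<dots> = 2 / x * (1 + \<bar>ln x\<bar> + \<bar>ln y\<bar>)"
      by (simp add: divide_divide_eq_right mult.commute)
    finally show ?thesis .
  next
    case False
    have "(ln x - ln y) / (x - y) \<le> 2 / x * 1"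
    proof (cases "y < x")
      case True
      have "ln x - ln y \<le> (x - y) / y" using y assms by (intro ln_diff_le) auto
      then have "(ln x - ln y) / (x - y) \<le> 1 / y"
        using True y by (simp add: field_simps)
      also have "\<dots> \<le> 1 / (x / 2)" using False assms by (intro frac_le) auto
      finally show ?thesis by simp
    next
      case yx: False
      have "ln y - ln x \<le> (y - x) / x" using y assms by (intro ln_diff_le) auto
      then have "(ln y - ln x) / (y - x) \<le> 1 / x"
        using yx y assms by (simp add: field_simps)
      also have "\<dots> \<le> 2 / x * 1" using assms by (simp add: field_simps)
      also have "(ln y - ln x) / (y - x) = (ln x - ln y) / (x - y)"
        by (metis minus_diff_eq minus_divide_divide)
      finally show ?thesis .
    qed
    also have "2 / x * 1 \<le> 2 / x * (1 + \<bar>ln x\<bar> + \<bar>ln y\<bar>)"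
      using assms by (intro mult_left_mono) auto
    finally show ?thesis .
  qed
  then show ?thesis using y by (simp add: log_kernel_def)
next
  case False
  then have "log_kernel x y = 0" by (auto simp: log_kernel_def)
  also have "0 \<le> indicat_real {0<..<1} y * (2 / x * (1 + \<bar>ln x\<bar> + \<bar>ln y\<bar>))"
    using assms by (intro mult_nonneg_nonneg) auto
  finally show ?thesis .
qed

lemma integrable_log_kernel:
  assumes "0 < x"
  shows "integrable lborel (log_kernel x)"
proof (rule Bochner_Integration.integrable_bound)
  have "integrable lborel (\<lambda>y. 2 / x * ((1 + \<bar>ln x\<bar>) * indicat_real {0<..<1} y
      + \<bar>indicat_real {0<..<1} y *\<^sub>R ln y\<bar>))"
    using set_integrable_ln unfolding set_integrable_def
    by (intro integrable_mult_right Bochner_Integration.integrable_add integrable_abs)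
       (auto simp: integrable_indicator_iff)
  then show "integrable lborel
      (\<lambda>y. indicat_real {0<..<1} y * (2 / x * (1 + \<bar>ln x\<bar> + \<bar>ln y\<bar>)))"
    by (rule Bochner_Integration.integrable_cong[THEN iffD1, rotated -1])
       (auto simp: indicator_def algebra_simps)
  show "AE y in lborel. norm (log_kernel x y)
      \<le> norm (indicat_real {0<..<1} y * (2 / x * (1 + \<bar>ln x\<bar> + \<bar>ln y\<bar>)))"
    using log_kernel_le[OF assms] log_kernel_nonneg[OF assms]
    by (intro AE_I2) (smt (verit) real_norm_def)
qed measurable

section \<open>Truncated integrals and principal values\<close>

text \<open>For small \<open>\<epsilon>\<close> the truncated integral of \<open>1 / (x - y)\<close> does not depend on \<open>\<epsilon>\<close>: the two
  contributions \<open>ln \<epsilon>\<close> cancel.\<close>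

lemma truncated_hilbert_indicator:
  assumes "0 < x" "x < 1" "0 < \<epsilon>" "\<epsilon> < x" "\<epsilon> < 1 - x"
  shows "has_bochner_integral lborel
      (\<lambda>y. indicator {y. \<epsilon> < \<bar>x - y\<bar>} y * (indicat_real {0<..<1} y / (x - y)))
      (ln x - ln (1 - x))"
proof -
  \<comment> \<open>The antiderivative is \<open>- ln (x - y)\<close> to the left of
    \<open>x\<close> and \<open>- ln (y - x)\<close> to the right.\<close>
  have 1: "has_bochner_integral lborel (\<lambda>y. (1 / (x - y)) * indicator {0..x - \<epsilon>} y)
      (- ln (x - (x - \<epsilon>)) - (- ln (x - 0)))"
    using assms by (intro has_bochner_integral_FTC_Icc_real)
      (auto intro!: derivative_eq_intros continuous_intros simp: field_simps)
  have 2: "has_bochner_integral lborel (\<lambda>y. (1 / (x - y)) * indicator {x + \<epsilon>..1} y)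
      (- ln (1 - x) - (- ln (x + \<epsilon> - x)))"
    using assms by (intro has_bochner_integral_FTC_Icc_real)
      (auto intro!: derivative_eq_intros continuous_intros simp: field_simps)
  have "has_bochner_integral lborel
      (\<lambda>y. (1 / (x - y)) * indicator {0..x - \<epsilon>} y + (1 / (x - y)) * indicator {x + \<epsilon>..1} y)
      (ln x - ln (1 - x))"
    using has_bochner_integral_add[OF 1 2] by simp
  \<comment> \<open>The two closed intervals differ from the truncated domain only in their four
    endpoints.\<close>
  moreover have "AE y in lborel.
      (1 / (x - y)) * indicator {0..x - \<epsilon>} y + (1 / (x - y)) * indicator {x + \<epsilon>..1} y
      = indicator {y. \<epsilon> < \<bar>x - y\<bar>} y * (indicat_real {0<..<1} y / (x - y))"
    using AE_lborel_singleton[of 0] AE_lborel_singleton[of 1]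
      AE_lborel_singleton[of "x - \<epsilon>"] AE_lborel_singleton[of "x + \<epsilon>"]
    by eventually_elim (use assms in \<open>auto simp: indicator_def abs_if split: if_splits\<close>)
  ultimately show ?thesis
    by (subst (asm) has_bochner_integral_cong_AE) auto
qed

lemma small_truncation:
  assumes "0 < x" "x < (1::real)"
  shows "\<forall>\<^sub>F \<epsilon> in at_right 0. 0 < \<epsilon> \<and> \<epsilon> < x \<and> \<epsilon> < 1 - x"
  using assms
  by (auto intro!: eventually_conj eventually_at_right_less order_tendstoD(2)[OF tendsto_ident_at])

lemma hilbert_transform_indicator:
  assumes "0 < x" "x < 1"
  shows "hilbert_transform (indicat_real {0<..<1}) x = ln x - ln (1 - x)"
  unfolding hilbert_transform_def
proof (rule tendsto_Lim)
  show "((\<lambda>\<epsilon>. LINT y:{y. \<epsilon> < \<bar>x - y\<bar>}|lebesgue. indicat_real {0<..<1} y / (x - y))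
      \<longlongrightarrow> ln x - ln (1 - x)) (at_right 0)"
  proof (rule tendsto_eventually, use small_truncation[OF assms] in eventually_elim)
    case (elim \<epsilon>)
    show ?case
      using has_bochner_integral_integral_eq[OF truncated_hilbert_indicator, of x \<epsilon>] elim assms
      by (simp add: set_lebesgue_integral_def integral_completion)
  qed
qed simp

text \<open>Dominated convergence along sequences: the nonnegative kernel dominates its own
  truncations, and off the diagonal each truncation is eventually inactive.\<close>

lemma truncated_log_kernel_tendsto:
  assumes "0 < x"
  shows "((\<lambda>\<epsilon>. LINT y|lborel. indicator {y. \<epsilon> < \<bar>x - y\<bar>} y * log_kernel x y)
      \<longlongrightarrow> (LINT y|lborel. log_kernel x y)) (at_right 0)"
  unfolding tendsto_at_iff_sequentially comp_def
proof (intro allI impI)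
  fix X :: "nat \<Rightarrow> real"
  assume X: "\<forall>i. X i \<in> {0<..} - {0}" "X \<longlonglongrightarrow> 0"
  show "(\<lambda>i. LINT y|lborel. indicator {y. X i < \<bar>x - y\<bar>} y * log_kernel x y)
      \<longlonglongrightarrow> (LINT y|lborel. log_kernel x y)"
  proof (rule integral_dominated_convergence[where w = "log_kernel x"])
    show "integrable lborel (log_kernel x)" using integrable_log_kernel[OF assms] .
    show "AE y in lborel. (\<lambda>i. indicator {y. X i < \<bar>x - y\<bar>} y * log_kernel x y)
        \<longlonglongrightarrow> log_kernel x y"
      using AE_lborel_singleton[of x]
    proof eventually_elim
      case (elim y)
      then have "\<forall>\<^sub>F i in sequentially. X i < \<bar>x - y\<bar>"
        using order_tendstoD(2)[OF X(2), of "\<bar>x - y\<bar>"] by simp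
      then show ?case
        by (intro tendsto_eventually, eventually_elim) simp
    qed
    show "AE y in lborel. norm (indicator {y. X i < \<bar>x - y\<bar>} y * log_kernel x y)
        \<le> log_kernel x y" for i
      using log_kernel_nonneg[OF assms] by (intro AE_I2) (auto simp: indicator_def)
  qed measurable
qed

text \<open>Writing \<open>ln y\<close> as \<open>ln x - (ln x - ln y)\<close> splits the truncated
  integral into \<open>ln x\<close> times the one already computed, minus a truncated integral of
  the kernel. Only the latter still varies for small \<open>\<epsilon>\<close>, and it converges
  absolutely.\<close>

lemma hilbert_transform_log:
  assumes "0 < x" "x < 1"
  shows "hilbert_transform (\<lambda>y. log_abs y * indicat_real {0<..<1} y) x
    = ln x * (ln x - ln (1 - x)) - (LINT y|lborel. log_kernel x y)"
  unfolding hilbert_transform_def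
proof (rule tendsto_Lim)
  let ?K = "\<lambda>\<epsilon>. LINT y|lborel. indicator {y. \<epsilon> < \<bar>x - y\<bar>} y * log_kernel x y"
  have "((\<lambda>\<epsilon>. ln x * (ln x - ln (1 - x)) - ?K \<epsilon>)
      \<longlongrightarrow> ln x * (ln x - ln (1 - x)) - (LINT y|lborel. log_kernel x y)) (at_right 0)"
    by (intro tendsto_intros truncated_log_kernel_tendsto assms)
  moreover have "\<forall>\<^sub>F \<epsilon> in at_right 0. ln x * (ln x - ln (1 - x)) - ?K \<epsilon> =
      (LINT y:{y. \<epsilon> < \<bar>x - y\<bar>}|lebesgue. log_abs y * indicat_real {0<..<1} y / (x - y))"
    using small_truncation[OF assms]
  proof eventually_elim
    case (elim \<epsilon>)
    let ?A = "\<lambda>y. indicator {y. \<epsilon> < \<bar>x - y\<bar>} y * (indicat_real {0<..<1} y / (x - y))"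
    let ?G = "\<lambda>y. indicator {y. \<epsilon> < \<bar>x - y\<bar>} y * log_kernel x y"
    have A: "has_bochner_integral lborel ?A (ln x - ln (1 - x))"
      using elim assms by (intro truncated_hilbert_indicator) auto
    have "integrable lborel ?G"
      by (rule Bochner_Integration.integrable_bound[OF integrable_log_kernel[OF assms(1)]])
         (auto simp: indicator_def)
    then have "has_bochner_integral lborel (\<lambda>y. ln x * ?A y - ?G y)
        (ln x * (ln x - ln (1 - x)) - ?K \<epsilon>)"
      using A by (intro has_bochner_integral_diff has_bochner_integral_mult_right
          has_bochner_integral_integrable) auto
    then have "ln x * (ln x - ln (1 - x)) - ?K \<epsilon> = (LINT y|lborel. ln x * ?A y - ?G y)"
      by (simp add: has_bochner_integral_integral_eq)
    also have "(\<lambda>y. ln x * ?A y - ?G y) = (\<lambda>y. indicator {y. \<epsilon> < \<bar>x - y\<bar>} y *\<^sub>R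
        (log_abs y * indicat_real {0<..<1} y / (x - y)))"
      by (auto simp: fun_eq_iff log_kernel_def log_abs_def indicator_def diff_divide_distrib)
    finally show ?case
      by (simp add: set_lebesgue_integral_def integral_completion log_abs_def)
  qed
  ultimately show "((\<lambda>\<epsilon>. LINT y:{y. \<epsilon> < \<bar>x - y\<bar>}|lebesgue.
      log_abs y * indicat_real {0<..<1} y / (x - y))
      \<longlongrightarrow> ln x * (ln x - ln (1 - x)) - (LINT y|lborel. log_kernel x y)) (at_right 0)"
    by (rule Lim_transform_eventually)
qed simp

lemma commutator_log_indicator:
  assumes "0 < x" "x < 1"
  shows "commutator log_abs hilbert_transform (indicat_real {0<..<1}) x
    = (LINT y|lborel. log_kernel x y)"
  unfolding commutator_def hilbert_transform_indicator[OF assms] hilbert_transform_log[OF assms]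
  using assms by (simp add: log_abs_def)

section \<open>The lower bound and the superlevel sets\<close>

lemma integral_log_kernel_ge:
  assumes "0 < x" "x < 1"
  shows "(ln x)\<^sup>2 / 2 \<le> (LINT y|lborel. log_kernel x y)"
proof -
  have "has_bochner_integral lborel (\<lambda>y. ((ln y - ln x) / y) * indicator {x..1} y)
      ((ln 1 - ln x)\<^sup>2 / 2 - (ln x - ln x)\<^sup>2 / 2)"
    using assms by (intro has_bochner_integral_FTC_Icc_real)
      (auto intro!: derivative_eq_intros continuous_intros simp: field_simps)
  then have H: "has_bochner_integral lborel (\<lambda>y. ((ln y - ln x) / y) * indicator {x..1} y)
      ((ln x)\<^sup>2 / 2)"
    by simp
  have "(LINT y|lborel. ((ln y - ln x) / y) * indicator {x..1} y) \<le> (LINT y|lborel. log_kernel x y)"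
  proof (rule integral_mono_AE)
    show "integrable lborel (\<lambda>y. ((ln y - ln x) / y) * indicator {x..1} y)"
      using H by (rule integrable.intros)
    show "integrable lborel (log_kernel x)"
      using assms by (intro integrable_log_kernel)
    \<comment> \<open>The inequality fails at \<open>y = 1\<close>, where the left side is
      \<open>- ln x > 0\<close> but the kernel vanishes.\<close>
    show "AE y in lborel. ((ln y - ln x) / y) * indicator {x..1} y \<le> log_kernel x y"
      using AE_lborel_singleton[of 1] AE_lborel_singleton[of x]
    proof eventually_elim
      case (elim y)
      show ?case
      proof (cases "x < y \<and> y < 1")
        case True
        \<comment> \<open>The numerator is nonnegative and \<open>0 < y - x < y\<close>.\<close>
        have "(ln y - ln x) / y \<le> (ln y - ln x) / (y - x)"
          using True assms by (intro divide_left_mono) auto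
        also have "\<dots> = (ln x - ln y) / (x - y)"
          by (metis minus_diff_eq minus_divide_divide)
        finally show ?thesis using True assms by (simp add: log_kernel_def)
      next
        case False
        then have "y \<notin> {x..1}" using elim by auto
        then show ?thesis using log_kernel_nonneg[OF assms(1)] by simp
      qed
    qed
  qed
  then show ?thesis using has_bochner_integral_integral_eq[OF H] by simp
qed

theorem mainTheorem1:
  "\<exists>c>0. \<forall>t>0.
     measure lebesgue
       {x \<in> {0<..<1}. \<bar>commutator log_abs hilbert_transform (indicat_real {0<..<1}) x\<bar> > t}
     \<ge> exp (- sqrt (c * t))"
proof (intro exI[of _ 2] conjI allI impI)
  fix t :: real
  assume t: "0 < t"
  let ?F = "\<lambda>x. LINT y|lborel. log_kernel x y"
  let ?S = "{x \<in> {0<..<1}. \<bar>?F x\<bar> > t}"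
  let ?a = "exp (- sqrt (2 * t))"
  have "?F \<in> borel_measurable borel"
    by measurable
  then have S: "?S \<in> sets borel"
    by measurable
  have "{0<..<?a} \<subseteq> ?S"
  proof
    fix x
    assume x: "x \<in> {0<..<?a}"
    moreover have "?a < 1" using t by simp
    ultimately have x01: "0 < x" "x < 1" by (simp, metis greaterThanLessThan_iff less_trans)
    have "ln x < - sqrt (2 * t)"
      using x by (metis exp_less_cancel_iff exp_ln greaterThanLessThan_iff)
    then have "(sqrt (2 * t))\<^sup>2 < (- ln x)\<^sup>2"
      using t by (intro power_strict_mono) auto
    then have "t < (ln x)\<^sup>2 / 2" using t by simp
    also have "\<dots> \<le> ?F x" using x01 by (rule integral_log_kernel_ge)
    finally show "x \<in> ?S" using x01 by simp
  qed
  moreover have "{0<..<?a} \<in> sets lebesgue" by simp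
  \<comment> \<open>Finiteness matters: \<open>measure\<close> is 0 on sets of infinite measure, so
    monotonicity requires it of the larger set.\<close>
  moreover have "?S \<in> lmeasurable"
  proof (rule fmeasurableI2)
    show "{0<..<1::real} \<in> lmeasurable" by simp
    show "?S \<subseteq> {0<..<1}" by blast
    show "?S \<in> sets lebesgue" using S by (rule sets_completionI_sets[of _ lborel, simplified])
  qed
  ultimately have "measure lebesgue {0<..<?a} \<le> measure lebesgue ?S"
    by (rule measure_mono_fmeasurable)
  \<comment> \<open>Measurability was shown for the kernel integral; since both sets lie in the unit
    interval, where the commutator equals that integral, they coincide.\<close>
  also have "?S = {x \<in> {0<..<1}.
      \<bar>commutator log_abs hilbert_transform (indicat_real {0<..<1}) x\<bar> > t}"
    by (auto simp: commutator_log_indicator)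
  finally show "?a \<le> measure lebesgue {x \<in> {0<..<1}.
      \<bar>commutator log_abs hilbert_transform (indicat_real {0<..<1}) x\<bar> > t}"
    by simp
qed simp

end
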